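(* Let $(a_i)_{i=1}^n$ be a sequence of integers such that $a_1 \geq 2$ and $a_{i+1} \geq a_i^2 - a_i + 1$ for all $i = 1,\ldots,n-1$. Then $(a_i)_{i=1}^n$ is the $n$-term greedy underapproximation sequence of the real number $\theta$ if and only if \[ \theta \in \left( \sum_{i=1}^n \frac{1}{a_i},\ \sum_{i=1}^{n-1} \frac{1}{a_i} + \frac{1}{a_n - 1} \right]. \]
   Context: For $\theta \in (0,1]$ let $G(\theta) = \lfloor 1/\theta \rfloor + 1$; equivalently $G(\theta)$ is the unique integer $a \geq 2$ with $1/a < \theta \leq 1/(a-1)$. The greedy underapproximation algorithm applied to $\theta$ produces $a_1 = G(\theta)$ and $a_{i+1} = G\left(\theta - \sum_{j=1}^i \frac{1}{a_j}\right)$ for $i \geq 1$; the first $n$ terms $(a_i)_{i=1}^n$ form the $n$-term greedy underapproximation sequence of $\theta$. Equivalently, $(a_i)_{i=1}^n$ is the $n$-term greedy underapproximation sequence of $\theta$ iff for each $k=1,\dots,n$ one has $\frac{1}{a_k} < \theta - \sum_{i=1}^{k-1}\frac{1}{a_i} \leq \frac{1}{a_k - 1}$. *)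

theory Defs
  imports Complex_Main
begin

text \<open>
  Only meant for \<open>\<theta>\<close> in the interval \<open>{0<..1}\<close>, where the value is at least 2.
\<close>

definition G :: "real \<Rightarrow> int" where
  "G \<theta> = \<lfloor>1 / \<theta>\<rfloor> + 1"

text \<open>
  The terms are indexed from 1.  Index 0 carries no meaning (the equation returns \<open>G \<theta>\<close> there)
  and is never used.
\<close>

fun greedy_term :: "real \<Rightarrow> nat \<Rightarrow> int" where
  "greedy_term \<theta> k = G (\<theta> - (\<Sum>j = 1..<k. 1 / real_of_int (greedy_term \<theta> j)))"

declare greedy_term.simps [simp del]

text \<open>
  The algorithm only accepts inputs in \<open>{0<..1}\<close>, so this range is part of the predicate.
  Only the values \<open>a 1, \<dots>, a n\<close> of the function \<open>a\<close> matter.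
\<close>

definition greedy_underapprox_seq :: "real \<Rightarrow> nat \<Rightarrow> (nat \<Rightarrow> int) \<Rightarrow> bool" where
  "greedy_underapprox_seq \<theta> n a \<longleftrightarrow>
     \<theta> \<in> {0<..1} \<and> (\<forall>k\<in>{1..n}. a k = greedy_term \<theta> k)"

end

(* The greedy choice at step k amounts to theta lying in the k-th interval
   (S k, S (k - 1) + 1 / (a k - 1)], where S denotes the partial sums. Since
   1 / (x - 1) = 1 / x + 1 / (x^2 - x), the growth condition on a says exactly that
   these intervals are nested, so membership in the last one implies all the others. *)
theory Submission
  imports Defs
begin

lemma G_eq_iff:
  assumes "a \<ge> 2"
  shows "G x = a \<longleftrightarrow> x \<in> {1 / real_of_int a <.. 1 / (real_of_int a - 1)}"
proof -
  have a: "real_of_int a \<ge> 2" using assms by simp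
  have "G x = a \<longleftrightarrow> real_of_int a - 1 \<le> 1 / x \<and> 1 / x < real_of_int a"
    unfolding G_def by linarith
  also have "\<dots> \<longleftrightarrow> x \<in> {1 / real_of_int a <.. 1 / (real_of_int a - 1)}"
  proof (cases "x > 0")
    case True
    with a show ?thesis by (auto simp: field_simps)
  next
    case False
    \<comment> \<open>Both sides are false here: the left one needs \<open>1 / x\<close> \<ge> a - 1
      \<ge> 1, the right one needs x > 0. The bound also covers x = 0, where \<open>1 / x\<close> is
      0.\<close>
    then have "1 / x \<le> 0" by (simp add: divide_nonneg_nonpos)
    moreover have "1 / real_of_int a > 0" using a by simp
    ultimately show ?thesis using False a by (simp; linarith)
  qed
  finally show ?thesis .
qed

text \<open>With x, y consecutive terms, adding the partial sum before x to both sides compares the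
  right ends of two consecutive intervals.\<close>

lemma inverse_pred_le:
  fixes x y :: int
  assumes "x \<ge> 2" and "y \<ge> x\<^sup>2 - x + 1"
  shows "1 / real_of_int x + 1 / (real_of_int y - 1) \<le> 1 / (real_of_int x - 1)"
proof -
  define u where "u = real_of_int x"
  have u: "u \<ge> 2" using assms(1) by (simp add: u_def)
  have "real_of_int (x\<^sup>2 - x + 1) \<le> real_of_int y"
    using assms(2) by (simp only: of_int_le_iff)
  then have "u * (u - 1) \<le> real_of_int y - 1"
    by (simp add: u_def power2_eq_square algebra_simps)
  moreover have "u * (u - 1) > 0" using u by simp
  ultimately have "1 / (real_of_int y - 1) \<le> 1 / (u * (u - 1))"
    by (intro divide_left_mono) auto
  moreover have "1 / u + 1 / (u * (u - 1)) = 1 / (u - 1)"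
    using u by (simp add: field_simps)
  ultimately show ?thesis unfolding u_def by linarith
qed

text \<open>Trades the recursion through earlier greedy terms for a partial sum of \<open>a\<close>.
  Nothing is asked of \<open>a k\<close> itself, so this can serve as an induction step that
  establishes \<open>a k\<close>.\<close>

lemma greedy_term_eq:
  assumes "\<And>j. 1 \<le> j \<Longrightarrow> j < k \<Longrightarrow> a j = greedy_term \<theta> j" and "k \<ge> 1"
  shows "greedy_term \<theta> k = G (\<theta> - (\<Sum>i = 1..k - 1. 1 / real_of_int (a i)))"
proof -
  have "(\<Sum>j = 1..<k. 1 / real_of_int (greedy_term \<theta> j)) = (\<Sum>i = 1..k - 1. 1 / real_of_int (a i))"
    using assms by (intro sum.cong) auto
  then show ?thesis by (simp add: greedy_term.simps[of \<theta> k])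
qed

theorem theorem2p1:
  fixes n :: nat and a :: "nat \<Rightarrow> int" and \<theta> :: real
  assumes "n \<ge> 1"
    and "a 1 \<ge> 2"
    and "\<forall>i\<in>{1..n - 1}. a (i + 1) \<ge> (a i)\<^sup>2 - a i + 1"
  shows "greedy_underapprox_seq \<theta> n a \<longleftrightarrow>
    \<theta> \<in> {(\<Sum>i = 1..n. 1 / real_of_int (a i)) <..
          (\<Sum>i = 1..n - 1. 1 / real_of_int (a i)) + 1 / (real_of_int (a n) - 1)}"
proof -
  define S where "S k = (\<Sum>i = 1..k. 1 / real_of_int (a i))" for k
  define I where "I k = {S k <.. S (k - 1) + 1 / (real_of_int (a k) - 1)}" for k
  have S_Suc: "S (Suc k) = S k + 1 / real_of_int (a (Suc k))" for k
    by (simp add: S_def)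
  have growth: "a (Suc k) \<ge> (a k)\<^sup>2 - a k + 1" if "1 \<le> k" "k < n" for k
    using assms(3) that by simp
  have a_ge: "a k \<ge> 2" if "1 \<le> k" "k \<le> n" for k
    using that
  proof (induction k rule: dec_induct)
    case base
    show ?case by (fact assms(2))
  next
    case (step k)
    then have "a k \<ge> 2" by simp
    \<comment> \<open>The growth condition then even gives a (k + 1) \<ge> 3.\<close>
    then have "2 * 1 \<le> a k * (a k - 1)" by (intro mult_mono) auto
    then show ?case using growth[of k] step by (simp add: power2_eq_square algebra_simps)
  qed
  have mem_I: "\<theta> \<in> I k \<longleftrightarrow> G (\<theta> - S (k - 1)) = a k" if "1 \<le> k" "k \<le> n" for k
  proof -
    have "S k = S (k - 1) + 1 / real_of_int (a k)"
      using S_Suc[of "k - 1"] that by simp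
    then show ?thesis
      unfolding G_eq_iff[OF a_ge[OF that]] I_def by auto
  qed
  have nested: "I (Suc k) \<subseteq> I k" if "1 \<le> k" "k < n" for k
  proof -
    \<comment> \<open>Left ends increase because the terms are positive; right ends decrease by
      \<open>inverse_pred_le\<close>.\<close>
    have "S k \<le> S (Suc k)"
      using a_ge[of "Suc k"] that by (simp add: S_Suc)
    moreover have "S k = S (k - 1) + 1 / real_of_int (a k)"
      using S_Suc[of "k - 1"] that by simp
    ultimately show ?thesis
      using inverse_pred_le[OF a_ge growth, of k] that by (auto simp: I_def)
  qed
  have I_mono: "I n \<subseteq> I k" if "1 \<le> k" "k \<le> n" for k
    using that(2,1)
  \<comment> \<open>Downward induction from n, as nesting passes from k + 1 to k.\<close>
  proof (induction k rule: inc_induct)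
    case (step k)
    then show ?case using nested[of k] by force
  qed simp
  have "greedy_underapprox_seq \<theta> n a \<longleftrightarrow> \<theta> \<in> I n"
  proof
    assume "greedy_underapprox_seq \<theta> n a"
    then have "a k = greedy_term \<theta> k" if "1 \<le> k" "k \<le> n" for k
      using that by (simp add: greedy_underapprox_seq_def)
    \<comment> \<open>This direction needs only the greedy choice at the last index.\<close>
    then show "\<theta> \<in> I n"
      using mem_I[of n] greedy_term_eq[of n a \<theta>] assms(1) by (simp add: S_def)
  next
    assume \<theta>: "\<theta> \<in> I n"
    have "\<theta> \<in> {0<..1}"
    proof -
      \<comment> \<open>\<open>I 1\<close> is the interval (1 / a 1, 1 / (a 1 - 1)], inside (0, 1]
        since a 1 \<ge> 2.\<close>
      have "\<theta> \<in> I 1" using \<theta> I_mono[of 1] assms(1) by auto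
      moreover have "S 1 > 0" "S 0 + 1 / (real_of_int (a 1) - 1) \<le> 1"
        using assms(2) by (auto simp: S_def)
      ultimately show ?thesis by (auto simp: I_def)
    qed
    moreover have "a k = greedy_term \<theta> k" if "1 \<le> k" "k \<le> n" for k
      using that
    \<comment> \<open>Strong induction, since the k-th greedy term depends on all earlier
      ones.\<close>
    proof (induction k rule: less_induct)
      case (less k)
      then have "greedy_term \<theta> k = G (\<theta> - S (k - 1))"
        unfolding S_def by (intro greedy_term_eq) auto
      also have "\<dots> = a k"
        using mem_I[of k] I_mono[of k] \<theta> less.prems by blast
      finally show ?case by simp
    qed
    ultimately show "greedy_underapprox_seq \<theta> n a"
      by (simp add: greedy_underapprox_seq_def)
  qed
  then show ?thesis by (simp add: I_def S_def)
qed

end
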